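(* Let $M\ge 2$ be an integer, $\theta_1,\ldots,\theta_M\in\Theta$, and $P_j\in\mathcal{P}_{\theta_j}$ for $j\in\{1,\ldots,M\}$. Suppose that there exists $\epsilon\in(0,1]$ such that $$\frac{M^{-1}\inf_{Q\in\mathcal{Q}(\mathcal{X})}\sum_{j=1}^M\mathrm{KL}(P_j,Q)+\log(2-M^{-1})}{\log M}\le 1-\epsilon.$$ Then, writing $\eta:=\min_{1\le j<k\le M}d(\theta_j,\theta_k)/2$, we have $\mathcal{M}_-(\delta)\ge g(\eta)$ for all $\delta\in(0,\epsilon)$.
   Context: Setting: $(\Theta,d)$ is a non-empty pseudo-metric space (i.e. $d:\Theta\times\Theta\to[0,\infty)$ is symmetric, satisfies $d(\theta,\theta)=0$ and the triangle inequality, but $d(\theta_1,\theta_2)=0$ is allowed for $\theta_1\ne\theta_2$), equipped with the topology induced by the open balls of $d$ and the corresponding Borel $\sigma$-algebra. For each $\theta\in\Theta$, $\mathcal{P}_\theta$ is a family of probability measures on a measurable space $(\mathcal{X},\mathcal{A})$, and $\mathcal{P}_\Theta:=\{\mathcal{P}_\theta:\theta\in\Theta\}$. The function $g:[0,\infty)\to[0,\infty)$ is increasing (non-decreasing) and the loss is $L(\theta_1,\theta_2):=g(d(\theta_1,\theta_2))$. $\hat\Theta$ is the set of all measurable functions (estimators) from $\mathcal{X}$ to $\Theta$. Lower minimax $(1-\delta)$th quantile: $\mathcal{M}_-(\delta):=\inf\{r\in[0,\infty):\inf_{\hat\theta\in\hat\Theta}\sup_{\theta\in\Theta}\sup_{P_\theta\in\mathcal{P}_\theta}P_\theta\{L(\hat\theta,\theta)>r\}\le\delta\}$.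 $\mathcal{Q}(\mathcal{X})$ is the set of all probability measures on $\mathcal{X}$, and $\mathrm{KL}(P,Q)=\int\log(dP/dQ)\,dP$ (equal to $+\infty$ if $P\not\ll Q$) is the Kullback–Leibler divergence. *)

theory Defs
  imports "HOL-Probability.Probability"
begin

section \<open>Pseudo-metric spaces\<close>

definition pseudo_metric_on :: "'a set \<Rightarrow> ('a \<Rightarrow> 'a \<Rightarrow> real) \<Rightarrow> bool" where
  "pseudo_metric_on \<Theta> d \<longleftrightarrow>
     (\<forall>x\<in>\<Theta>. \<forall>y\<in>\<Theta>. 0 \<le> d x y) \<and>
     (\<forall>x\<in>\<Theta>. d x x = 0) \<and>
     (\<forall>x\<in>\<Theta>. \<forall>y\<in>\<Theta>. d x y = d y x) \<and>
     (\<forall>x\<in>\<Theta>. \<forall>y\<in>\<Theta>. \<forall>z\<in>\<Theta>. d x z \<le> d x y + d y z)"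

definition pball :: "'a set \<Rightarrow> ('a \<Rightarrow> 'a \<Rightarrow> real) \<Rightarrow> 'a \<Rightarrow> real \<Rightarrow> 'a set" where
  "pball \<Theta> d x r = {y \<in> \<Theta>. d x y < r}"

definition ptopology :: "'a set \<Rightarrow> ('a \<Rightarrow> 'a \<Rightarrow> real) \<Rightarrow> 'a topology" where
  "ptopology \<Theta> d = topology_generated_by {pball \<Theta> d x r | x r. x \<in> \<Theta> \<and> 0 < r}"

definition pborel :: "'a set \<Rightarrow> ('a \<Rightarrow> 'a \<Rightarrow> real) \<Rightarrow> 'a measure" where
  "pborel \<Theta> d = sigma \<Theta> {U. openin (ptopology \<Theta> d) U}"

lemma topspace_ptopology:
  assumes "pseudo_metric_on \<Theta> d"
  shows "topspace (ptopology \<Theta> d) = \<Theta>"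
proof -
  have "x \<in> pball \<Theta> d x 1" if "x \<in> \<Theta>" for x
    using assms that by (simp add: pball_def pseudo_metric_on_def)
  moreover have "pball \<Theta> d x r \<subseteq> \<Theta>" for x r
    by (auto simp: pball_def)
  ultimately show ?thesis
    unfolding ptopology_def topology_generated_by_topspace
    by (fastforce intro: zero_less_one)
qed

lemma space_pborel: "pseudo_metric_on \<Theta> d \<Longrightarrow> space (pborel \<Theta> d) = \<Theta>"
  unfolding pborel_def
  using openin_subset[of "ptopology \<Theta> d"] topspace_ptopology[of \<Theta> d]
  by (subst space_measure_of) auto


section \<open>Kullback--Leibler divergence\<close>

text \<open>
  The library's \<open>KL_divergence b Q P\<close> (reference measure first) is a Bochner integral: it is
  \<open>0\<close> if the log-density is not integrable, and it does not exclude that \<open>P\<close> is not absolutely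
  continuous with respect to \<open>Q\<close>. Hence this extended-real version, in which the integral is the
  difference of the integrals of the positive and negative parts of \<open>ln (dP/dQ)\<close>; the latter is
  finite for probability measures \<open>P\<close> and \<open>Q\<close>, as \<open>t ln t\<close> is bounded below.
\<close>

definition KL :: "'x measure \<Rightarrow> 'x measure \<Rightarrow> ereal" where
  "KL P Q =
     (if absolutely_continuous Q P
      then enn2ereal (\<integral>\<^sup>+ x. ennreal (entropy_density (exp 1) Q P x) \<partial>P)
         - enn2ereal (\<integral>\<^sup>+ x. ennreal (- entropy_density (exp 1) Q P x) \<partial>P)
      else \<infinity>)"

lemma KL_eq_KL_divergence:
  assumes "absolutely_continuous Q P" "integrable P (entropy_density (exp 1) Q P)"
  shows "KL P Q = ereal (KL_divergence (exp 1) Q P)"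
proof -
  let ?f = "entropy_density (exp 1) Q P"
  have fin: "(\<integral>\<^sup>+ x. ennreal (?f x) \<partial>P) \<noteq> \<infinity>" "(\<integral>\<^sup>+ x. ennreal (- ?f x) \<partial>P) \<noteq> \<infinity>"
    using assms(2) by (auto simp: real_integrable_def)
  obtain p where p: "0 \<le> p" "(\<integral>\<^sup>+ x. ennreal (?f x) \<partial>P) = ennreal p"
    using fin(1) by (auto elim: ennreal_cases)
  obtain n where n: "0 \<le> n" "(\<integral>\<^sup>+ x. ennreal (- ?f x) \<partial>P) = ennreal n"
    using fin(2) by (auto elim: ennreal_cases)
  show ?thesis
    using assms(1) p n
    by (simp add: KL_def KL_divergence_def real_lebesgue_integral_def[OF assms(2)] enn2ereal_ennreal)
qed


section \<open>Minimax quantiles\<close>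

text \<open>
  The measure \<open>X\<close> serves only as a measurable space; \<open>space (prob_algebra X)\<close> is the set of all
  probability measures on it. Probabilities are taken in \<^typ>\<open>ennreal\<close>, so that a supremum over an
  empty \<open>\<P> \<theta>\<close> is \<open>0\<close>, and the quantile in \<^typ>\<open>ereal\<close>, so that the infimum of the empty set is
  \<open>\<infinity>\<close>.
\<close>

definition lower_minimax_quantile ::
  "'a set \<Rightarrow> ('a \<Rightarrow> 'a \<Rightarrow> real) \<Rightarrow> 'x measure \<Rightarrow> ('a \<Rightarrow> 'x measure set) \<Rightarrow> (real \<Rightarrow> real)
    \<Rightarrow> real \<Rightarrow> ereal" where
  "lower_minimax_quantile \<Theta> d X \<P> g \<delta> =
     Inf {ereal r | r. 0 \<le> r \<and>
       (INF \<theta>h \<in> measurable X (pborel \<Theta> d). SUP \<theta>\<in>\<Theta>. SUP P\<in>\<P> \<theta>.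
          emeasure P {x \<in> space X. g (d (\<theta>h x) \<theta>) > r}) \<le> ennreal \<delta>}"

end

theory Submission
  imports Defs
begin

text \<open>
  An estimator with loss at most \<open>r < g \<eta>\<close> at \<open>\<theta> j\<close> lies within distance less than \<open>\<eta>\<close> of \<open>\<theta> j\<close>,
  so the success events \<open>A j\<close> of the \<open>M\<close> hypotheses are disjoint. The Donsker--Varadhan bound
  \<open>KL P Q \<ge> \<integral>h dP - \<integral>exp h dQ + 1\<close>, applied to \<open>P j\<close> with \<open>h = ln M * indicator (A j) - ln c\<close>, where
  \<open>c = 2 - 1 / M\<close>, and summed over \<open>j\<close> yields
  \<open>ln M * (\<Sum>j. P j (A j)) \<le> (\<Sum>j. KL (P j) Q) + M * ln c\<close> since \<open>\<Sum>j. Q (A j) \<le> 1\<close>. The hypothesis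
  then bounds the average success probability by \<open>1 - \<epsilon>\<close>, so that some hypothesis fails with
  probability at least \<open>\<epsilon>\<close>.
\<close>

text \<open>With \<open>D = dP/dQ\<close>, integrate \<open>ln t <= t - 1\<close> at
  \<open>t = exp h / D\<close> against \<open>P\<close>. The result is linear in \<open>Q\<close>,
  unlike the sharper form with the logarithm of the integral of \<open>exp h\<close>, so it can be
  summed over several hypotheses against one common \<open>Q\<close>.\<close>

lemma KL_ge_Donsker_Varadhan:
  fixes h :: "'x \<Rightarrow> real"
  assumes "prob_space P" "prob_space Q" and sets: "sets P = sets Q"
    and hP: "integrable P h" and hQ: "integrable Q (\<lambda>x. exp (h x))"
  shows "ereal ((\<integral>x. h x \<partial>P) - (\<integral>x. exp (h x) \<partial>Q) + 1) \<le> KL P Q"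
proof (cases "absolutely_continuous Q P")
  case False
  then show ?thesis by (simp add: KL_def)
next
  case ac: True
  interpret P: prob_space P by fact
  interpret Q: prob_space Q by fact
  let ?f = "entropy_density (exp 1) Q P"
  have "finite_measure P" by unfold_locales
  from Q.real_RN_deriv[OF this ac sets] obtain D
    where D[measurable]: "D \<in> borel_measurable Q"
      and RN: "AE x in Q. RN_deriv Q P x = ennreal (D x)"
      and pos: "AE x in P. 0 < D x"
      and nonneg: "\<And>x. 0 \<le> D x"
    by this auto
  have "P = density Q (RN_deriv Q P)"
    using ac sets by (rule Q.density_RN_deriv[symmetric])
  also have "\<dots> = density Q D"
    using RN by (auto intro!: density_cong)
  finally have P_eq: "P = density Q D" .
  have [measurable]: "h \<in> borel_measurable Q"
    using borel_measurable_integrable[OF hP] sets by (simp cong: measurable_cong_sets)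
  have [measurable]: "?f \<in> borel_measurable Q"
    by (intro measurable_entropy_density)
  have f_P: "?f \<in> borel_measurable P"
    using sets by (simp cong: measurable_cong_sets)

  have f_eq: "AE x in P. ?f x = ln (D x)"
    using absolutely_continuous_AE[OF sets ac RN]
    by eventually_elim (simp add: entropy_density_def log_def nonneg)
  \<comment> \<open>The integrand is \<open>exp (h x)\<close> where \<open>D x > 0\<close> and 0
    where \<open>D x = 0\<close>, since division by zero gives 0. Mass of \<open>Q\<close> on
    \<open>D = 0\<close> is lost, hence only an inequality in \<open>le\<close>.\<close>
  have int0: "integrable Q (\<lambda>x. D x * (exp (h x) / D x))"
    by (rule Bochner_Integration.integrable_bound[OF hQ]) auto
  then have int: "integrable P (\<lambda>x. exp (h x) / D x)"
    unfolding P_eq using nonneg by (subst integrable_real_density) auto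
  have "(\<integral>x. exp (h x) / D x \<partial>P) = (\<integral>x. D x * (exp (h x) / D x) \<partial>Q)"
    unfolding P_eq using nonneg by (subst integral_real_density) auto
  also have "\<dots> \<le> (\<integral>x. exp (h x) \<partial>Q)"
    using int0 hQ by (rule integral_mono) auto
  finally have le: "(\<integral>x. exp (h x) / D x \<partial>P) \<le> (\<integral>x. exp (h x) \<partial>Q)" .

  \<comment> \<open>This integrable minorant of the log-density serves twice: it makes the negative
    part of the log-density integrable, and its integral dominates the claimed lower bound.\<close>
  define l where "l x = h x + 1 - exp (h x) / D x" for x
  have l_int: "integrable P l"
    unfolding l_def using hP int by auto
  have f_ge: "AE x in P. l x \<le> ?f x"
    using f_eq pos
  proof eventually_elim
    case (elim x)
    have "ln (exp (h x) / D x) \<le> exp (h x) / D x - 1"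
      using elim by (intro ln_le_minus_one) auto
    then show ?case
      using elim by (simp add: ln_div l_def)
  qed

  show ?thesis
  proof (cases "(\<integral>\<^sup>+ x. ennreal (?f x) \<partial>P) = \<infinity>")
    \<comment> \<open>In \<open>ereal\<close>, infinity minus anything is infinity, so
      \<open>KL P Q\<close> is infinite here.\<close>
    case True
    then show ?thesis using ac by (simp add: KL_def)
  next
    case fin: False
    have "(\<integral>\<^sup>+ x. ennreal (- ?f x) \<partial>P) \<le> (\<integral>\<^sup>+ x. ennreal (- l x) \<partial>P)"
      using f_ge by (intro nn_integral_mono_AE) (auto elim!: eventually_mono intro!: ennreal_leI)
    also have "\<dots> < \<infinity>"
      using l_int by (simp add: real_integrable_def less_top)
    finally have f_int: "integrable P ?f"
      using fin f_P by (auto simp: real_integrable_def)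
    have "(\<integral>x. h x \<partial>P) - (\<integral>x. exp (h x) \<partial>Q) + 1 \<le> (\<integral>x. l x \<partial>P)"
      unfolding l_def using hP int le by (simp add: P.prob_space)
    also have "\<dots> \<le> (\<integral>x. ?f x \<partial>P)"
      using l_int f_int f_ge by (rule integral_mono_AE)
    finally show ?thesis
      using KL_eq_KL_divergence[OF ac f_int] by (simp add: KL_divergence_def)
  qed
qed

text \<open>A single \<open>Q\<close> has total mass at most 1 to share among the disjoint
  \<open>A j\<close>, so hypotheses that each favour their own event must on average diverge from
  \<open>Q\<close>. The bound is uniform in \<open>Q\<close> and thus passes to the infimum.\<close>

lemma sum_measure_le_sum_KL:
  fixes P :: "'i \<Rightarrow> 'x measure" and A :: "'i \<Rightarrow> 'x set"
  assumes fin: "finite I" and ne: "I \<noteq> {}"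
    and P: "\<And>j. j \<in> I \<Longrightarrow> prob_space (P j)" "\<And>j. j \<in> I \<Longrightarrow> sets (P j) = sets Q"
    and Q: "prob_space Q"
    and A: "\<And>j. j \<in> I \<Longrightarrow> A j \<in> sets Q" "disjoint_family_on A I"
  defines "M \<equiv> real (card I)"
  shows "ereal (ln M * (\<Sum>j\<in>I. measure (P j) (A j)) - M * ln (2 - 1 / M)) \<le> (\<Sum>j\<in>I. KL (P j) Q)"
proof -
  interpret Q: prob_space Q by fact
  have M1: "1 \<le> M"
  proof -
    have "1 \<le> card I" using fin ne by (simp add: Suc_leI card_gt_0_iff)
    then show ?thesis by (simp add: M_def)
  qed
  \<comment> \<open>This value normalises the test functions: the integrals of their exponentials
    sum to at most \<open>(M + (M - 1)) / c = M\<close>, which cancels the \<open>M\<close> summands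
    \<open>+ 1\<close>.\<close>
  define c where "c = 2 - 1 / M"
  have c: "0 < c" and Mc: "M * c = 2 * M - 1"
    using M1 by (simp_all add: c_def field_simps)
  have "ereal (ln M * measure (P j) (A j) - ln c - (1 + (M - 1) * measure Q (A j)) / c + 1)
      \<le> KL (P j) Q" if j: "j \<in> I" for j
  proof -
    interpret P: prob_space "P j" using P j by blast
    let ?h = "\<lambda>x. ln M * indicator (A j) x - ln c"
    have [measurable]: "A j \<in> sets Q" "A j \<in> sets (P j)"
      using A P j by auto
    have ind: "integrable (P j) (indicat_real (A j))" "integrable Q (indicat_real (A j))"
      by (rule P.integrable_const_bound[where B = 1] Q.integrable_const_bound[where B = 1];
          simp)+
    \<comment> \<open>The factor \<open>exp (ln M * indicator)\<close> is \<open>M\<close> on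
      \<open>A j\<close> and 1 off it, hence affine in the indicator.\<close>
    have exp_h: "exp (?h x) = (1 + (M - 1) * indicator (A j) x) / c" for x
      using c M1 by (auto simp: exp_diff indicator_def)
    have "ereal ((\<integral>x. ?h x \<partial>P j) - (\<integral>x. exp (?h x) \<partial>Q) + 1) \<le> KL (P j) Q"
    proof (rule KL_ge_Donsker_Varadhan)
      show "integrable (P j) ?h" using ind by simp
      show "integrable Q (\<lambda>x. exp (?h x))" unfolding exp_h using ind by simp
    qed (use P Q j in auto)
    also have "(\<integral>x. ?h x \<partial>P j) = ln M * measure (P j) (A j) - ln c"
      using ind by (simp add: P.prob_space)
    also have "(\<integral>x. exp (?h x) \<partial>Q) = (1 + (M - 1) * measure Q (A j)) / c"
      unfolding exp_h using ind by (simp add: Q.prob_space)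
    finally show ?thesis by simp
  qed
  then have "(\<Sum>j\<in>I. ereal (ln M * measure (P j) (A j) - ln c
        - (1 + (M - 1) * measure Q (A j)) / c + 1)) \<le> (\<Sum>j\<in>I. KL (P j) Q)"
    by (rule sum_mono)
  moreover have "(\<Sum>j\<in>I. ln M * measure (P j) (A j) - ln c
        - (1 + (M - 1) * measure Q (A j)) / c + 1)
      = ln M * (\<Sum>j\<in>I. measure (P j) (A j)) - M * ln c
        - (M + (M - 1) * (\<Sum>j\<in>I. measure Q (A j))) / c + M"
    by (simp add: sum.distrib sum_subtractf sum_distrib_left sum_divide_distrib[symmetric] M_def)
  moreover have "(M + (M - 1) * (\<Sum>j\<in>I. measure Q (A j))) / c \<le> M"
  proof -
    have "(\<Sum>j\<in>I. measure Q (A j)) = measure Q (\<Union>j\<in>I. A j)"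
      using fin A by (intro Q.finite_measure_finite_Union[symmetric]) auto
    also have "\<dots> \<le> 1"
      by (rule Q.prob_le_1)
    finally have "(M - 1) * (\<Sum>j\<in>I. measure Q (A j)) \<le> (M - 1) * 1"
      using M1 by (intro mult_left_mono) auto
    then show ?thesis
      using c Mc by (simp add: pos_divide_le_eq)
  qed
  ultimately show ?thesis
    unfolding c_def by (auto intro: order_trans[rotated])
qed

text \<open>By symmetry the strict sublevel sets are balls around \<open>t\<close>: generators of
  the topology for positive radius, empty otherwise.\<close>

lemma measurable_pseudo_metric_pborel:
  assumes d: "pseudo_metric_on \<Theta> d" and t: "t \<in> \<Theta>"
  shows "(\<lambda>y. d y t) \<in> borel_measurable (pborel \<Theta> d)"
proof (rule borel_measurableI_less)
  fix a :: real
  have "{y \<in> space (pborel \<Theta> d). d y t < a} = pball \<Theta> d t a"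
    using d t by (auto simp: space_pborel pball_def pseudo_metric_on_def)
  moreover have "pball \<Theta> d t a \<in> sets (pborel \<Theta> d)"
  proof (cases "0 < a")
    case True
    then have "openin (ptopology \<Theta> d) (pball \<Theta> d t a)"
      unfolding ptopology_def using t by (intro topology_generated_by_Basis) auto
    moreover have "{U. openin (ptopology \<Theta> d) U} \<subseteq> Pow \<Theta>"
      using openin_subset[of "ptopology \<Theta> d"] topspace_ptopology[OF d] by auto
    ultimately show ?thesis
      by (simp add: pborel_def)
  next
    case False
    moreover have "0 \<le> d t y" if "y \<in> \<Theta>" for y
      using d t that by (simp add: pseudo_metric_on_def)
    ultimately have "pball \<Theta> d t a = {}"
      by (fastforce simp: pball_def)
    then show ?thesis by simp
  qed
  ultimately show "{y \<in> space (pborel \<Theta> d). d y t < a} \<in> sets (pborel \<Theta> d)"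
    by simp
qed

text \<open>This makes the success and failure events measurable; \<open>emeasure\<close> would be 0
  on a non-measurable set. As \<open>g\<close> is monotone only on the half-line, it is replaced by
  \<open>g (max 0 s)\<close>, which is monotone on all reals and agrees with \<open>g\<close> at
  distances.\<close>

lemma measurable_loss:
  fixes g :: "real \<Rightarrow> real"
  assumes d: "pseudo_metric_on \<Theta> d" and g: "mono_on {0..} g" and t: "t \<in> \<Theta>"
    and f: "f \<in> measurable X (pborel \<Theta> d)"
  shows "(\<lambda>x. g (d (f x) t)) \<in> borel_measurable X"
proof -
  have "mono (\<lambda>s. g (max 0 s))"
    using g by (auto simp: mono_def mono_on_def)
  then have [measurable]: "(\<lambda>s. g (max 0 s)) \<in> borel_measurable borel"
    by (rule borel_measurable_mono)
  have [measurable]: "(\<lambda>x. d (f x) t) \<in> borel_measurable X"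
    using measurable_compose[OF f measurable_pseudo_metric_pborel[OF d t]] .
  have "(\<lambda>x. g (max 0 (d (f x) t))) \<in> borel_measurable X"
    by measurable
  moreover have "g (max 0 (d (f x) t)) = g (d (f x) t)" if "x \<in> space X" for x
    using measurable_space[OF f that] d t by (simp add: space_pborel pseudo_metric_on_def max_def)
  ultimately show ?thesis
    by (simp cong: measurable_cong)
qed

theorem lemma7:
  fixes \<Theta> :: "'a set" and d :: "'a \<Rightarrow> 'a \<Rightarrow> real"
    and X :: "'x measure" and \<P> :: "'a \<Rightarrow> 'x measure set" and g :: "real \<Rightarrow> real"
    and M :: nat and \<theta> :: "nat \<Rightarrow> 'a" and P :: "nat \<Rightarrow> 'x measure" and \<epsilon> :: real
  assumes "\<Theta> \<noteq> {}" and "pseudo_metric_on \<Theta> d"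
    and "\<And>t. t \<in> \<Theta> \<Longrightarrow> \<P> t \<subseteq> space (prob_algebra X)"
    and "\<And>t. 0 \<le> t \<Longrightarrow> 0 \<le> g t" and "mono_on {0..} g"
    and "2 \<le> M"
    and "\<And>j. j \<in> {1..M} \<Longrightarrow> \<theta> j \<in> \<Theta>"
    and "\<And>j. j \<in> {1..M} \<Longrightarrow> P j \<in> \<P> (\<theta> j)"
    and "0 < \<epsilon>" and "\<epsilon> \<le> 1"
    and "(ereal (1 / real M) * (INF Q \<in> space (prob_algebra X). \<Sum>j = 1..M. KL (P j) Q)
            + ereal (ln (2 - 1 / real M))) / ereal (ln (real M)) \<le> ereal (1 - \<epsilon>)"
  shows "\<forall>\<delta>. 0 < \<delta> \<and> \<delta> < \<epsilon> \<longrightarrow>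
    lower_minimax_quantile \<Theta> d X \<P> g \<delta>
      \<ge> ereal (g (Min {d (\<theta> j) (\<theta> k) | j k. 1 \<le> j \<and> j < k \<and> k \<le> M} / 2))"
proof (intro allI impI, elim conjE)
  fix \<delta> :: real
  assume \<delta>: "0 < \<delta>" "\<delta> < \<epsilon>"
  define S where "S = {d (\<theta> j) (\<theta> k) | j k. 1 \<le> j \<and> j < k \<and> k \<le> M}"
  define \<eta> where "\<eta> = Min S / 2"
  have d: "0 \<le> d x y" "d x y = d y x" "z \<in> \<Theta> \<Longrightarrow> d x z \<le> d x y + d y z"
    if "x \<in> \<Theta>" "y \<in> \<Theta>" for x y z
    using assms(2) that unfolding pseudo_metric_on_def by blast+
  have S_fin: "finite S"
  proof (rule finite_subset)
    show "S \<subseteq> (\<lambda>(j, k). d (\<theta> j) (\<theta> k)) ` ({1..M} \<times> {1..M})"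
      by (force simp: S_def)
  qed auto
  \<comment> \<open>The pair (1, 2) exists because \<open>2 <= M\<close>; thus \<open>S\<close> is
    nonempty and \<open>Min S\<close> is one of the distances.\<close>
  have "d (\<theta> 1) (\<theta> 2) \<in> S"
    using assms(6) unfolding S_def by fastforce
  then have "Min S \<in> S"
    using S_fin by (intro Min_in) auto
  then have \<eta>0: "0 \<le> \<eta>"
    using assms(7) d(1) by (auto simp: S_def \<eta>_def)
  have sep: "2 * \<eta> \<le> d (\<theta> j) (\<theta> k)" if jk: "j \<in> {1..M}" "k \<in> {1..M}" "j \<noteq> k" for j k
  proof -
    have "d (\<theta> j) (\<theta> k) \<in> S"
    proof (cases "j < k")
      case True
      then show ?thesis using jk by (auto simp: S_def)
    next
      case False
      then have "d (\<theta> k) (\<theta> j) \<in> S" using jk unfolding S_def by fastforce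
      then show ?thesis using d(2) assms(7) jk by simp
    qed
    then show ?thesis using S_fin by (simp add: \<eta>_def)
  qed
  have P: "prob_space (P j)" "sets (P j) = sets X" if "j \<in> {1..M}" for j
    using assms(3)[OF assms(7)[OF that]] assms(8)[OF that] by (auto simp: space_prob_algebra)

  show "ereal (g (Min {d (\<theta> j) (\<theta> k) | j k. 1 \<le> j \<and> j < k \<and> k \<le> M} / 2))
      \<le> lower_minimax_quantile \<Theta> d X \<P> g \<delta>"
    unfolding lower_minimax_quantile_def S_def[symmetric] \<eta>_def[symmetric]
  proof (rule Inf_greatest, clarsimp)
    fix r :: real
    assume "0 \<le> r"
      and r: "(INF \<theta>h \<in> measurable X (pborel \<Theta> d). SUP \<theta>\<in>\<Theta>. SUP P\<in>\<P> \<theta>.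
          emeasure P {x \<in> space X. r < g (d (\<theta>h x) \<theta>)}) \<le> ennreal \<delta>"
    show "g \<eta> \<le> r"
    proof (rule ccontr)
      assume "\<not> g \<eta> \<le> r"
      then have r_less: "r < g \<eta>" by simp
      \<comment> \<open>If \<open>r < g \<eta>\<close>, every estimator has worst-case failure
        probability at least \<open>\<epsilon> > \<delta>\<close>, so \<open>r\<close> cannot be
        admissible in the quantile.\<close>
      have "ennreal \<epsilon> \<le> (SUP \<theta>\<in>\<Theta>. SUP P\<in>\<P> \<theta>. emeasure P {x \<in> space X. r < g (d (f x) \<theta>)})"
        if f: "f \<in> measurable X (pborel \<Theta> d)" for f
      proof -
        define A where "A j = {x \<in> space X. g (d (f x) (\<theta> j)) \<le> r}" for j
        have fx: "f x \<in> \<Theta>" if "x \<in> space X" for x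
          using measurable_space[OF f that] space_pborel[OF assms(2)] by simp
        have A_sets: "A j \<in> sets X" if "j \<in> {1..M}" for j
        proof -
          have [measurable]: "(\<lambda>x. g (d (f x) (\<theta> j))) \<in> borel_measurable X"
            using measurable_loss[OF assms(2,5,7) f] that .
          show ?thesis unfolding A_def by measurable
        qed
        have A_close: "d (f x) (\<theta> j) < \<eta>" if "x \<in> A j" for x j
        proof (rule ccontr)
          assume "\<not> d (f x) (\<theta> j) < \<eta>"
          then have "g \<eta> \<le> g (d (f x) (\<theta> j))"
            using \<eta>0 by (intro mono_onD[OF assms(5)]) auto
          then show False using that r_less by (simp add: A_def)
        qed
        have disj: "disjoint_family_on A {1..M}"
          unfolding disjoint_family_on_def
        proof (intro ballI impI, rule ccontr)
          fix j k assume jk: "j \<in> {1..M}" "k \<in> {1..M}" "j \<noteq> k" and "A j \<inter> A k \<noteq> {}"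
          then obtain x where x: "x \<in> A j" "x \<in> A k" by auto
          then have in\<Theta>: "f x \<in> \<Theta>" "\<theta> j \<in> \<Theta>" "\<theta> k \<in> \<Theta>"
            using fx assms(7) jk by (auto simp: A_def)
          \<comment> \<open>Both summands are strictly below \<open>\<eta>\<close>, while the
            separation is at least \<open>2 * \<eta>\<close>.\<close>
          have "d (\<theta> j) (\<theta> k) \<le> d (f x) (\<theta> j) + d (f x) (\<theta> k)"
            using d(2,3) in\<Theta> by metis
          then show False
            using A_close[OF x(1)] A_close[OF x(2)] sep[OF jk] by simp
        qed

        define p where "p = (\<Sum>j=1..M. measure (P j) (A j))"
        have lnM: "0 < ln (real M)" using assms(6) by simp
        let ?K = "ln M * p - M * ln (2 - 1 / M)"
        have "ereal ?K \<le> (INF Q \<in> space (prob_algebra X). \<Sum>j = 1..M. KL (P j) Q)"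
        proof (rule INF_greatest)
          fix Q assume "Q \<in> space (prob_algebra X)"
          then have "prob_space Q" "sets Q = sets X" by (auto simp: space_prob_algebra)
          then show "ereal ?K \<le> (\<Sum>j = 1..M. KL (P j) Q)"
            using sum_measure_le_sum_KL[of "{1..M}" P Q A] P A_sets disj assms(6)
            by (simp add: p_def)
        qed
        \<comment> \<open>Replacing the possibly infinite infimum by the finite lower bound
          \<open>?K\<close> turns the hypothesis into an inequality between reals.\<close>
        then have "(ereal (1 / M) * ereal ?K + ereal (ln (2 - 1 / M))) / ereal (ln M) \<le> ereal (1 - \<epsilon>)"
          using assms(6)
          by (intro order_trans[OF _ assms(11)] ereal_divide_right_mono add_right_mono
              ereal_mult_left_mono) auto
        then have "(1 / M * ?K + ln (2 - 1 / M)) / ln M \<le> 1 - \<epsilon>"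
          using lnM by (simp split: if_splits)
        \<comment> \<open>The two \<open>ln (2 - 1 / M)\<close> terms cancel, leaving the average
          success probability.\<close>
        moreover have "(1 / M * ?K + ln (2 - 1 / M)) / ln M = p / M"
          using assms(6) by (simp add: field_simps)
        ultimately have p: "p \<le> M * (1 - \<epsilon>)"
          using assms(6) by (simp add: field_simps)
        \<comment> \<open>An average of at most \<open>1 - \<epsilon>\<close> forces some term to be
          at most \<open>1 - \<epsilon>\<close>.\<close>
        have "\<exists>j\<in>{1..M}. measure (P j) (A j) \<le> 1 - \<epsilon>"
        proof (rule ccontr)
          assume "\<not> ?thesis"
          then have "(\<Sum>j=1..M. 1 - \<epsilon>) < p"
            unfolding p_def using assms(6) by (intro sum_strict_mono) (auto simp: not_le)
          then show False using p by simp
        qed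
        then obtain j where j: "j \<in> {1..M}" "measure (P j) (A j) \<le> 1 - \<epsilon>" by blast
        interpret Pj: prob_space "P j" using P j by blast
        have space: "space (P j) = space X"
          using P j by (intro sets_eq_imp_space_eq) auto
        have "\<epsilon> \<le> measure (P j) (space (P j) - A j)"
          using Pj.prob_compl[of "A j"] A_sets P j by simp
        also have "space (P j) - A j = {x \<in> space X. r < g (d (f x) (\<theta> j))}"
          by (auto simp: space A_def)
        finally have "ennreal \<epsilon> \<le> emeasure (P j) {x \<in> space X. r < g (d (f x) (\<theta> j))}"
          by (simp add: Pj.emeasure_eq_measure ennreal_leI)
        also have "\<dots> \<le> (SUP P\<in>\<P> (\<theta> j). emeasure P {x \<in> space X. r < g (d (f x) (\<theta> j))})"
          using assms(8) j by (intro SUP_upper)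
        also have "\<dots> \<le> (SUP \<theta>\<in>\<Theta>. SUP P\<in>\<P> \<theta>. emeasure P {x \<in> space X. r < g (d (f x) \<theta>)})"
          using assms(7) j by (intro SUP_upper)
        finally show ?thesis .
      qed
      then have "ennreal \<epsilon> \<le> ennreal \<delta>"
        by (intro order_trans[OF INF_greatest r])
      then show False using \<delta> by (simp add: ennreal_le_iff)
    qed
  qed
qed

end
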